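(* Let $c^\ast$ be the optimal value of the linear inverse problem (LIP): minimize $c(f)$ over $f\in\mathbb{H}$ subject to $\|x-\phi(f)\|\le\epsilon$, and let $f^\ast$ be an optimal solution of it. Let $\bar\eta,\hat\eta,\bar\epsilon>0$ satisfy $\bar\eta\le c^\ast<\hat\eta$ and $e(f^\ast)\le\bar\epsilon^2<\epsilon^2$. Then the min-max problem $$\min_{h\in B_c}\ \sup_{\lambda\in\Lambda(\bar\eta,B)}\ L(\lambda,h)=2\,l(\lambda)-\langle\lambda,\phi(h)\rangle$$ is equivalent to the LIP. In other words, a pair $(h^\ast,\lambda^\ast)\in B_c\times\Lambda(\bar\eta,B)$ is a saddle point of this min-max problem if and only if $c^\ast h^\ast$ is an optimal solution of the LIP and $$\lambda^\ast=\frac{c^\ast}{\|\phi(h^\ast)\|\sqrt{\epsilon^2-e(h^\ast)}}\,\bigl(x-c^\ast\phi(h^\ast)\bigr).$$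
   Context: $\mathbb{H}$ is a finite-dimensional real Hilbert space; $\mathbb{R}^n$ carries an inner product $\langle\cdot,\cdot\rangle$ with associated norm $\|\cdot\|$; $\phi:\mathbb{H}\to\mathbb{R}^n$ is linear; $x\in\mathbb{R}^n$, $\epsilon>0$. Standing assumptions. (1) The cost $c:\mathbb{H}\to\mathbb{R}$ is positively homogeneous ($c(rf)=rc(f)$ for all $r\ge0$, $f\in\mathbb{H}$), and $B_c:=\{f\in\mathbb{H}:c(f)\le1\}$ is compact and convex. (2) $\|x\|>\epsilon>0$ and there exists $f\in\mathbb{H}$ with $\|x-\phi(f)\|<\epsilon$. Definitions. $e(h):=\min_{\theta\in\mathbb{R}}\|x-\theta\phi(h)\|^2$ for $h\in\mathbb{H}$. $l(\lambda):=\sqrt{\langle\lambda,x\rangle-\epsilon\|\lambda\|}$ for $\lambda\in\mathbb{R}^n$ with $\langle\lambda,x\rangle\ge\epsilon\|\lambda\|$. $$B:=\frac{\epsilon\,\hat\eta^2}{(\|x\|-\epsilon)\sqrt{\epsilon^2-\bar\epsilon^2}},\qquad \Lambda(\bar\eta,B):=\{\lambda\in\mathbb{R}^n:\langle\lambda,x\rangle\ge\epsilon\|\lambda\|,\ l(\lambda)\ge\bar\eta,\ \|\lambda\|\le B\}.$$ A pair $(h^\ast,\lambda^\ast)\in B_c\times\Lambda(\bar\eta,B)$ is a saddle point if $L(\lambda,h^\ast)\le L(\lambda^\ast,h^\ast)\le L(\lambda^\ast,h)$ for all $h\in B_c$, $\lambda\in\Lambda(\bar\eta,B)$. *)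

theory Defs
  imports "HOL-Analysis.Analysis"
begin

text \<open>
  The type variables \<open>'h\<close> (the Hilbert space) and \<open>'v\<close> (the signal space \<open>\<real>\<^sup>n\<close>) have sort
  \<^class>\<open>euclidean_space\<close>, so that \<open>\<real>\<^sup>n\<close> may carry any inner product.
\<close>

definition pos_homogeneous :: "('h::real_vector \<Rightarrow> real) \<Rightarrow> bool" where
  "pos_homogeneous c \<longleftrightarrow> (\<forall>r\<ge>0. \<forall>f. c (r *\<^sub>R f) = r * c f)"

definition unit_sublevel :: "('h \<Rightarrow> real) \<Rightarrow> 'h set" where
  "unit_sublevel c = {f. c f \<le> 1}"

definition lip_feasible :: "('h \<Rightarrow> 'v::real_normed_vector) \<Rightarrow> 'v \<Rightarrow> real \<Rightarrow> 'h \<Rightarrow> bool" where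
  "lip_feasible \<phi> x \<epsilon> f \<longleftrightarrow> norm (x - \<phi> f) \<le> \<epsilon>"

definition lip_value :: "('h \<Rightarrow> real) \<Rightarrow> ('h \<Rightarrow> 'v::real_normed_vector) \<Rightarrow> 'v \<Rightarrow> real \<Rightarrow> real" where
  "lip_value c \<phi> x \<epsilon> = (INF f\<in>{f. lip_feasible \<phi> x \<epsilon> f}. c f)"

definition lip_optimal ::
    "('h \<Rightarrow> real) \<Rightarrow> ('h \<Rightarrow> 'v::real_normed_vector) \<Rightarrow> 'v \<Rightarrow> real \<Rightarrow> 'h \<Rightarrow> bool" where
  "lip_optimal c \<phi> x \<epsilon> f \<longleftrightarrow> is_arg_min c (lip_feasible \<phi> x \<epsilon>) f"

lemma lip_optimal_value:
  assumes "lip_optimal c \<phi> x \<epsilon> f"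
  shows "c f = lip_value c \<phi> x \<epsilon>"
  unfolding lip_value_def
  by (rule cInf_eq_minimum[symmetric])
    (use assms in \<open>auto simp: lip_optimal_def is_arg_min_def not_less\<close>)

definition line_err :: "('h \<Rightarrow> 'v::real_normed_vector) \<Rightarrow> 'v \<Rightarrow> 'h \<Rightarrow> real" where
  "line_err \<phi> x h = (INF \<theta>. (norm (x - \<theta> *\<^sub>R \<phi> h))\<^sup>2)"

text \<open>The infimum over \<open>\<theta>\<close> is a minimum.\<close>

lemma line_err_attained:
  fixes x :: "'v::real_inner"
  shows "\<exists>\<theta>. line_err \<phi> x h = (norm (x - \<theta> *\<^sub>R \<phi> h))\<^sup>2
           \<and> (\<forall>\<theta>'. (norm (x - \<theta> *\<^sub>R \<phi> h))\<^sup>2 \<le> (norm (x - \<theta>' *\<^sub>R \<phi> h))\<^sup>2)"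
proof -
  define v where "v = \<phi> h"
  define t where "t = inner x v / inner v v"
  define r where "r = x - t *\<^sub>R v"
  have orth: "inner r v = 0"
    by (cases "v = 0") (simp_all add: r_def t_def inner_diff_left)
  have min: "(norm (x - t *\<^sub>R v))\<^sup>2 \<le> (norm (x - s *\<^sub>R v))\<^sup>2" for s
  proof -
    have eq: "x - s *\<^sub>R v = r + (t - s) *\<^sub>R v"
      by (simp add: r_def algebra_simps)
    have "(norm (r + (t - s) *\<^sub>R v))\<^sup>2 = (norm r)\<^sup>2 + (norm ((t - s) *\<^sub>R v))\<^sup>2"
      by (rule norm_add_Pythagorean) (simp add: orthogonal_def orth)
    then show ?thesis
      by (simp add: eq flip: r_def)
  qed
  have "line_err \<phi> x h = (norm (x - t *\<^sub>R v))\<^sup>2"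
    unfolding line_err_def v_def[symmetric]
    by (rule cInf_eq_minimum) (use min in auto)
  with min show ?thesis
    unfolding v_def by blast
qed

definition dual_l :: "'v::real_inner \<Rightarrow> real \<Rightarrow> 'v \<Rightarrow> real" where
  "dual_l x \<epsilon> lam = sqrt (inner lam x - \<epsilon> * norm lam)"

definition dual_bound :: "'v::real_normed_vector \<Rightarrow> real \<Rightarrow> real \<Rightarrow> real \<Rightarrow> real" where
  "dual_bound x \<epsilon> \<eta>hat \<epsilon>bar =
     \<epsilon> * \<eta>hat\<^sup>2 / ((norm x - \<epsilon>) * sqrt (\<epsilon>\<^sup>2 - \<epsilon>bar\<^sup>2))"

definition dual_set :: "'v::real_inner \<Rightarrow> real \<Rightarrow> real \<Rightarrow> real \<Rightarrow> 'v set" where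
  "dual_set x \<epsilon> \<eta> B = {lam. inner lam x \<ge> \<epsilon> * norm lam \<and> dual_l x \<epsilon> lam \<ge> \<eta> \<and> norm lam \<le> B}"

definition lagr :: "('h \<Rightarrow> 'v::real_inner) \<Rightarrow> 'v \<Rightarrow> real \<Rightarrow> 'v \<Rightarrow> 'h \<Rightarrow> real" where
  "lagr \<phi> x \<epsilon> lam h = 2 * dual_l x \<epsilon> lam - inner lam (\<phi> h)"

text \<open>In \<open>L lam h\<close> the maximising variable comes first.\<close>

definition saddle_point ::
    "'h set \<Rightarrow> 'v set \<Rightarrow> ('v \<Rightarrow> 'h \<Rightarrow> real) \<Rightarrow> 'h \<Rightarrow> 'v \<Rightarrow> bool" where
  "saddle_point H S L hs lams \<longleftrightarrow> hs \<in> H \<and> lams \<in> S \<and>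
     (\<forall>h\<in>H. \<forall>lam\<in>S. L lam hs \<le> L lams hs \<and> L lams hs \<le> L lams h)"

end

theory Submission
  imports Defs
begin

text \<open>
  Let \<open>f\<close> be an optimal solution of the LIP with value \<open>k > 0\<close>, and put \<open>p = \<phi> f\<close> and \<open>q = x - p\<close>.
  Scaling \<open>f\<close> down would lower its cost, so \<open>\<parallel>q\<parallel> = \<epsilon>\<close>, and moving from \<open>f\<close> towards any
  point of cost at most \<open>k\<close> cannot decrease the residual, so \<open>\<langle>q, \<phi> g - p\<rangle> \<le> 0\<close> whenever
  \<open>c g \<le> k\<close>. In particular all optimal solutions have the same image \<open>p\<close>.
  On the dual side, completing the square gives
  \<open>k L(\<lambda>, h) = k\<^sup>2 - (l \<lambda> - k)\<^sup>2 + (\<langle>\<lambda>, x - k \<phi> h\<rangle> - \<epsilon> \<parallel>\<lambda>\<parallel>)\<close>,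
  so for \<open>k \<phi> h = p\<close> the maximum over \<open>\<lambda>\<close> is \<open>k\<close>, attained only at
  \<open>\<lambda> = (k\<^sup>2 / \<langle>q, p\<rangle>) q\<close>. Saddle points are interchangeable, so this determines the dual component
  of every saddle point. If \<open>k h\<close> had a residual \<open>w \<noteq> q\<close>, then tilting \<open>q\<close> slightly towards \<open>w\<close>,
  and rescaling so that \<open>l\<close> remains \<open>k\<close>, would push \<open>L\<close> above \<open>k\<close>.
\<close>

section \<open>Optimality conditions for the LIP\<close>

lemma strictly_feasible_cost:
  fixes \<phi> :: "'h::real_vector \<Rightarrow> 'v::real_normed_vector"
  assumes lin: "linear \<phi>" and hom: "pos_homogeneous c"
    and opt: "lip_optimal c \<phi> x \<epsilon> f" and pos: "0 < c f"
    and strict: "norm (x - \<phi> g) < \<epsilon>"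
  shows "c f < c g"
proof (rule ccontr)
  assume "\<not> c f < c g"
  then have le: "c g \<le> c f" by simp
  have "((\<lambda>s. norm (x - s *\<^sub>R \<phi> g)) \<longlongrightarrow> norm (x - 1 *\<^sub>R \<phi> g)) (at_left 1)"
    by (intro tendsto_intros)
  then have "\<forall>\<^sub>F s in at_left 1. norm (x - s *\<^sub>R \<phi> g) < \<epsilon>"
    using strict by (auto dest: order_tendstoD(2)[where a = \<epsilon>])
  moreover have "\<forall>\<^sub>F s in at_left (1::real). s \<in> {0<..<1}"
    by (rule eventually_at_leftI[of 0]) auto
  ultimately have "\<forall>\<^sub>F s in at_left (1::real). norm (x - s *\<^sub>R \<phi> g) < \<epsilon> \<and> s \<in> {0<..<1}"
    by eventually_elim simp
  then obtain s where s: "norm (x - s *\<^sub>R \<phi> g) < \<epsilon>" "0 < s" "s < 1"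
    using eventually_happens'[OF trivial_limit_at_left_real] by fastforce
  have "lip_feasible \<phi> x \<epsilon> (s *\<^sub>R g)"
    using s lin by (simp add: lip_feasible_def linear_scale)
  then have "c f \<le> c (s *\<^sub>R g)"
    using opt by (auto simp: lip_optimal_def is_arg_min_def not_less)
  also have "\<dots> = s * c g"
    using hom s by (simp add: pos_homogeneous_def)
  \<comment> \<open>The factor \<open>s\<close> is strictly decreasing only on a positive number,
    and \<open>c g\<close> may have any sign; hence the detour through \<open>c f\<close>.\<close>
  also have "\<dots> \<le> s * c f"
    using le s by simp
  also have "\<dots> < c f"
    using s pos by simp
  finally show False by simp
qed

lemma lip_optimal_residual:
  fixes \<phi> :: "'h::real_vector \<Rightarrow> 'v::real_normed_vector"
  assumes "linear \<phi>" "pos_homogeneous c" "lip_optimal c \<phi> x \<epsilon> f" "0 < c f"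
  shows "norm (x - \<phi> f) = \<epsilon>"
  using strictly_feasible_cost[OF assms, of f] assms(3)
  by (fastforce simp: lip_optimal_def is_arg_min_def lip_feasible_def)

text \<open>Homogeneity makes the sublevel set at height \<open>k\<close> equal to \<open>k\<close>
  times the unit one, so it inherits convexity.\<close>

lemma sublevel_convex_combination:
  assumes hom: "pos_homogeneous c" and conv: "convex (unit_sublevel c)"
    and k: "0 < k" and "c f \<le> k" "c g \<le> k" and t: "0 \<le> t" "t \<le> 1"
  shows "c ((1 - t) *\<^sub>R f + t *\<^sub>R g) \<le> k"
proof -
  have scale: "c ((1 / k) *\<^sub>R h) = c h / k" for h
    using hom k by (simp add: pos_homogeneous_def)
  have "(1 / k) *\<^sub>R f \<in> unit_sublevel c" "(1 / k) *\<^sub>R g \<in> unit_sublevel c"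
    unfolding unit_sublevel_def mem_Collect_eq scale using assms by simp_all
  then have "(1 - t) *\<^sub>R ((1 / k) *\<^sub>R f) + t *\<^sub>R ((1 / k) *\<^sub>R g) \<in> unit_sublevel c"
    using conv t by (intro convexD) auto
  then have "c ((1 / k) *\<^sub>R ((1 - t) *\<^sub>R f + t *\<^sub>R g)) \<le> 1"
    by (simp add: unit_sublevel_def scaleR_add_right mult.commute)
  then show ?thesis
    using k by (simp add: scale)
qed

lemma lip_variational_inequality:
  fixes \<phi> :: "'h::real_vector \<Rightarrow> 'v::real_inner"
  assumes lin: "linear \<phi>" and hom: "pos_homogeneous c" and conv: "convex (unit_sublevel c)"
    and opt: "lip_optimal c \<phi> x \<epsilon> f" and pos: "0 < c f" and g: "c g \<le> c f"
  shows "inner (x - \<phi> f) (\<phi> g - \<phi> f) \<le> 0"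
proof (rule ccontr)
  define a where "a = inner (x - \<phi> f) (\<phi> g - \<phi> f)"
  define b where "b = (norm (\<phi> g - \<phi> f))\<^sup>2"
  assume "\<not> inner (x - \<phi> f) (\<phi> g - \<phi> f) \<le> 0"
  then have a: "0 < a" by (simp add: a_def)
  have b: "0 \<le> b" by (simp add: b_def)
  \<comment> \<open>A step \<open>t\<close> changes the squared residual by
    \<open>- t * (2 * a - t * b)\<close>. The unconstrained minimiser \<open>a / b\<close> may
    exceed 1; adding \<open>a\<close> to the denominator keeps \<open>t\<close> in the segment and
    the decrease strict.\<close>
  define t where "t = a / (a + b)"
  have t: "0 < t" "t \<le> 1" "t * b < 2 * a"
    using a b add_pos_nonneg[of "2 * (a * a)" "a * b"] by (auto simp: t_def field_simps)
  define h where "h = (1 - t) *\<^sub>R f + t *\<^sub>R g"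
  have "\<phi> h = \<phi> f + t *\<^sub>R (\<phi> g - \<phi> f)"
    using lin by (simp add: h_def linear_add linear_scale) (simp add: algebra_simps)
  then have res: "x - \<phi> h = (x - \<phi> f) - t *\<^sub>R (\<phi> g - \<phi> f)"
    by simp
  have "(norm (u - t *\<^sub>R v))\<^sup>2 = (norm u)\<^sup>2 - 2 * t * inner u v + t\<^sup>2 * (norm v)\<^sup>2" for u v :: 'v
    unfolding power2_norm_eq_inner
    by (simp add: inner_diff_left inner_diff_right inner_commute[of v u] power2_eq_square
        algebra_simps)
  then have "(norm (x - \<phi> h))\<^sup>2 = (norm (x - \<phi> f))\<^sup>2 - 2 * t * a + t\<^sup>2 * b"
    unfolding a_def b_def res .
  also have "\<dots> = (norm (x - \<phi> f))\<^sup>2 - t * (2 * a - t * b)"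
    by (simp add: power2_eq_square algebra_simps)
  also have "\<dots> < (norm (x - \<phi> f))\<^sup>2"
    using t by simp
  finally have "norm (x - \<phi> h) < norm (x - \<phi> f)"
    by (rule power_less_imp_less_base) simp
  then have "norm (x - \<phi> h) < \<epsilon>"
    using lip_optimal_residual[OF lin hom opt pos] by simp
  from strictly_feasible_cost[OF lin hom opt pos this]
  have "c f < c h" .
  moreover have "c h \<le> c f"
    unfolding h_def using t g pos by (intro sublevel_convex_combination[OF hom conv]) auto
  ultimately show False by simp
qed

text \<open>Two residuals \<open>q\<close>, \<open>w\<close> of equal norm satisfy
  \<open>(norm (q - w))\<^sup>2 = 2 * inner q (q - w)\<close>, and the variational inequality makes
  the right side nonpositive.\<close>

lemma lip_optimal_image_unique:
  fixes \<phi> :: "'h::real_vector \<Rightarrow> 'v::real_inner"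
  assumes lin: "linear \<phi>" and hom: "pos_homogeneous c" and conv: "convex (unit_sublevel c)"
    and f: "lip_optimal c \<phi> x \<epsilon> f" and pos: "0 < c f" and g: "lip_optimal c \<phi> x \<epsilon> g"
  shows "\<phi> g = \<phi> f"
proof -
  define q w where "q = x - \<phi> f" and "w = x - \<phi> g"
  have eq: "c g = c f"
    using f g by (simp add: lip_optimal_value)
  have n: "norm q = \<epsilon>" "norm w = \<epsilon>"
    unfolding q_def w_def
    using lip_optimal_residual[OF lin hom f pos] lip_optimal_residual[OF lin hom g] eq pos by simp_all
  have "inner q (q - w) \<le> 0"
    using lip_variational_inequality[OF lin hom conv f pos, of g] eq by (simp add: q_def w_def)
  then have "(norm (q - w))\<^sup>2 \<le> 0"
    using n power2_norm_eq_inner[of q] power2_norm_eq_inner[of w]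
    unfolding power2_norm_eq_inner[of "q - w"]
    by (simp add: inner_diff_left inner_diff_right inner_commute[of w q])
  then show ?thesis
    by (simp add: q_def w_def)
qed

text \<open>By Pythagoras, the squared residual minus the line error is the squared length of the
  residual's projection onto the line through \<open>\<phi> h\<close>. This turns the square roots
  in the multiplier formula into inner products.\<close>

lemma line_err_residual:
  fixes x :: "'v::real_inner"
  shows "norm (\<phi> h) * sqrt ((norm (x - k *\<^sub>R \<phi> h))\<^sup>2 - line_err \<phi> x h)
           = \<bar>inner (x - k *\<^sub>R \<phi> h) (\<phi> h)\<bar>"
proof (cases "\<phi> h = 0")
  case False
  define v t r where "v = \<phi> h" and "t = inner x v / inner v v" and "r = x - t *\<^sub>R v"
  have v: "inner v v \<noteq> 0" using False by (simp add: v_def)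
  have orth: "inner r v = 0"
    using v by (simp add: r_def t_def inner_diff_left)
  have split: "(norm (x - s *\<^sub>R v))\<^sup>2 = (norm r)\<^sup>2 + ((t - s) * norm v)\<^sup>2" for s
  proof -
    have "(norm (r + (t - s) *\<^sub>R v))\<^sup>2 = (norm r)\<^sup>2 + (norm ((t - s) *\<^sub>R v))\<^sup>2"
      by (rule norm_add_Pythagorean) (simp add: orthogonal_def orth)
    moreover have "r + (t - s) *\<^sub>R v = x - s *\<^sub>R v"
      by (simp add: r_def algebra_simps)
    ultimately show ?thesis
      by (simp add: power_mult_distrib)
  qed
  have "line_err \<phi> x h = (norm (x - t *\<^sub>R v))\<^sup>2"
    unfolding line_err_def v_def[symmetric]
    by (rule cInf_eq_minimum) (auto simp: split)
  then have "(norm (x - k *\<^sub>R v))\<^sup>2 - line_err \<phi> x h = ((t - k) * norm v)\<^sup>2"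
    by (simp add: split)
  then have "norm v * sqrt ((norm (x - k *\<^sub>R v))\<^sup>2 - line_err \<phi> x h) = \<bar>(t - k) * (norm v)\<^sup>2\<bar>"
    by (simp add: abs_mult power2_eq_square)
  also have "(t - k) * (norm v)\<^sup>2 = inner (x - k *\<^sub>R v) v"
    using v by (simp add: t_def power2_norm_eq_inner field_simps inner_diff_left)
  finally show ?thesis
    by (simp add: v_def)
qed simp

section \<open>Maximising the Lagrangian over the dual variable\<close>

lemma lagr_complete_square:
  fixes x :: "'v::real_inner"
  assumes "0 < k" and "\<epsilon> * norm lam \<le> inner lam x"
  shows "lagr \<phi> x \<epsilon> lam h =
           k - (dual_l x \<epsilon> lam - k)\<^sup>2 / k + (inner lam (x - k *\<^sub>R \<phi> h) - \<epsilon> * norm lam) / k"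
proof -
  have sq: "inner lam x = (dual_l x \<epsilon> lam)\<^sup>2 + \<epsilon> * norm lam"
    using assms by (simp add: dual_l_def)
  show ?thesis
    using assms(1)
    by (simp add: lagr_def inner_diff_right sq field_simps power2_eq_square)
qed

lemma lagr_le_value:
  fixes x :: "'v::real_inner"
  assumes k: "0 < k" and lam: "\<epsilon> * norm lam \<le> inner lam x"
    and h: "norm (x - k *\<^sub>R \<phi> h) \<le> \<epsilon>"
  shows "lagr \<phi> x \<epsilon> lam h \<le> k"
proof -
  have "inner lam (x - k *\<^sub>R \<phi> h) \<le> norm lam * norm (x - k *\<^sub>R \<phi> h)"
    by (rule norm_cauchy_schwarz)
  also have "\<dots> \<le> \<epsilon> * norm lam"
    using h by (simp add: mult.commute[of "norm lam"] mult_right_mono)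
  finally have "(inner lam (x - k *\<^sub>R \<phi> h) - \<epsilon> * norm lam) / k \<le> 0"
    using k by (simp add: divide_nonpos_pos)
  moreover have "0 \<le> (dual_l x \<epsilon> lam - k)\<^sup>2 / k"
    using k by simp
  ultimately show ?thesis
    unfolding lagr_complete_square[where \<phi> = \<phi>, OF k lam] by linarith
qed

text \<open>Equality forces the square to vanish and Cauchy-Schwarz to be tight. Tightness makes
  \<open>lam\<close> a multiple of \<open>q\<close>, and \<open>dual_l x \<epsilon> lam = k\<close>
  fixes the factor.\<close>

lemma lagr_eq_value_imp:
  fixes x q :: "'v::real_inner"
  assumes k: "0 < k" and lam: "\<epsilon> * norm lam \<le> inner lam x"
    and q: "q = x - k *\<^sub>R \<phi> h" "norm q = \<epsilon>" and \<epsilon>: "0 < \<epsilon>"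
    and eq: "lagr \<phi> x \<epsilon> lam h = k"
  shows "lam = (k\<^sup>2 / inner q (x - q)) *\<^sub>R q"
proof -
  have cs: "inner lam q \<le> \<epsilon> * norm lam"
    using norm_cauchy_schwarz[of lam q] q by (simp add: mult.commute)
  have "(dual_l x \<epsilon> lam - k)\<^sup>2 = inner lam q - \<epsilon> * norm lam"
    using lagr_complete_square[where \<phi> = \<phi> and h = h, OF k lam] eq k by (simp add: q(1))
  with cs have l: "dual_l x \<epsilon> lam = k" and al: "inner lam q = norm lam * norm q"
    using zero_le_power2[of "dual_l x \<epsilon> lam - k"] q(2) by (auto simp: mult.commute)
  define s where "s = norm lam / \<epsilon>"
  from al have "norm lam *\<^sub>R q = \<epsilon> *\<^sub>R lam"
    using norm_cauchy_schwarz_eq q(2) by metis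
  then have "(1 / \<epsilon>) *\<^sub>R (norm lam *\<^sub>R q) = (1 / \<epsilon>) *\<^sub>R (\<epsilon> *\<^sub>R lam)"
    by simp
  then have s: "lam = s *\<^sub>R q"
    using \<epsilon> by (simp add: s_def)
  have "k\<^sup>2 = inner lam x - \<epsilon> * norm lam"
    using l lam by (auto simp: dual_l_def)
  also have "\<dots> = inner lam (x - q)"
    using al q(2) by (simp add: inner_diff_right)
  also have "\<dots> = s * inner q (x - q)"
    by (simp add: s)
  finally have "k\<^sup>2 = s * inner q (x - q)" .
  moreover from this have "inner q (x - q) \<noteq> 0"
    using k by auto
  ultimately show ?thesis
    by (simp add: s)
qed

text \<open>The radicand of \<open>dual_l\<close> is positively homogeneous of degree 1, so this
  factor brings it to \<open>k\<^sup>2\<close>.\<close>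

lemma dual_l_rescaled:
  fixes x q :: "'v::real_inner"
  assumes k: "0 < k" and D: "0 < inner q x - \<epsilon> * norm q"
    and lam: "lam = (k\<^sup>2 / (inner q x - \<epsilon> * norm q)) *\<^sub>R q"
  shows "dual_l x \<epsilon> lam = k" and "\<epsilon> * norm lam \<le> inner lam x"
proof -
  let ?D = "inner q x - \<epsilon> * norm q"
  have "inner lam x - \<epsilon> * norm lam = k\<^sup>2 / ?D * ?D"
    using D by (simp add: lam right_diff_distrib diff_divide_distrib)
  then have eq: "inner lam x - \<epsilon> * norm lam = k\<^sup>2"
    using D by simp
  then show "dual_l x \<epsilon> lam = k"
    using k by (simp add: dual_l_def)
  show "\<epsilon> * norm lam \<le> inner lam x"
    using eq zero_le_power2[of k] by linarith
qed

lemma lagr_gt_value: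
  fixes x q :: "'v::real_inner"
  assumes k: "0 < k" "\<eta> \<le> k" and \<epsilon>: "0 < \<epsilon>" and q: "norm q = \<epsilon>"
    and D: "0 < inner q (x - q)" and B: "k\<^sup>2 / inner q (x - q) * \<epsilon> < B"
    and w: "inner q (x - k *\<^sub>R \<phi> h) = \<epsilon>\<^sup>2" "x - k *\<^sub>R \<phi> h \<noteq> q"
  shows "\<exists>lam\<in>dual_set x \<epsilon> \<eta> B. k < lagr \<phi> x \<epsilon> lam h"
proof -
  \<comment> \<open>The tilt direction is orthogonal to \<open>q\<close>: both residuals have inner
    product \<open>\<epsilon>\<^sup>2\<close> with \<open>q\<close>.\<close>
  define d where "d = (x - k *\<^sub>R \<phi> h) - q"
  define Q where "Q t = q + t *\<^sub>R d" for t
  define E where "E t = inner (Q t) x - \<epsilon> * norm (Q t)" for t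
  have qq: "inner q q = \<epsilon>\<^sup>2"
    using q by (simp flip: power2_norm_eq_inner)
  have d: "inner q d = 0" "d \<noteq> 0"
    using w qq by (simp_all add: d_def inner_diff_right)
  have E0: "E 0 = inner q (x - q)"
    using q qq by (simp add: E_def Q_def inner_diff_right power2_eq_square)
  have Q_lim: "(Q \<longlongrightarrow> Q 0) (at_right 0)"
    unfolding Q_def by (intro tendsto_intros)
  have E_lim: "(E \<longlongrightarrow> E 0) (at_right 0)"
    unfolding E_def by (intro tendsto_intros Q_lim)
  have "((\<lambda>t. k\<^sup>2 / E t * norm (Q t)) \<longlongrightarrow> k\<^sup>2 / E 0 * norm (Q 0)) (at_right 0)"
    using D E0 by (intro tendsto_intros Q_lim E_lim) auto
  \<comment> \<open>The strict inequality in the hypothesis on \<open>B\<close> leaves room for a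
    small tilt within the dual set.\<close>
  then have "\<forall>\<^sub>F t in at_right 0. k\<^sup>2 / E t * norm (Q t) < B"
    by (rule order_tendstoD) (use B E0 q in \<open>simp add: Q_def\<close>)
  moreover have "\<forall>\<^sub>F t in at_right 0. 0 < E t"
    by (rule order_tendstoD(1)[OF E_lim]) (use D E0 in simp)
  moreover have "\<forall>\<^sub>F t in at_right (0::real). t \<in> {0<..<1}"
    by (rule eventually_at_rightI[of 0 1]) auto
  ultimately have "\<forall>\<^sub>F t in at_right 0. k\<^sup>2 / E t * norm (Q t) < B \<and> 0 < E t \<and> t \<in> {0<..<1}"
    by eventually_elim simp
  then obtain t where t: "k\<^sup>2 / E t * norm (Q t) < B" "0 < E t" "0 < t" "t < 1"
    using eventually_happens'[OF trivial_limit_at_right_real] by fastforce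
  define lam where "lam = (k\<^sup>2 / E t) *\<^sub>R Q t"
  note l = dual_l_rescaled[where q = "Q t", OF k(1) t(2)[unfolded E_def] lam_def[unfolded E_def]]
  have "lam \<in> dual_set x \<epsilon> \<eta> B"
    using l k t by (simp add: dual_set_def lam_def)
  moreover have "k < lagr \<phi> x \<epsilon> lam h"
  proof -
    have n: "(norm (Q t))\<^sup>2 = \<epsilon>\<^sup>2 + t\<^sup>2 * (norm d)\<^sup>2"
      using d qq unfolding Q_def power2_norm_eq_inner
      by (simp add: inner_add_left inner_add_right inner_commute power2_eq_square)
    have i: "inner (Q t) (x - k *\<^sub>R \<phi> h) = \<epsilon>\<^sup>2 + t * (norm d)\<^sup>2"
    proof -
      have "x - k *\<^sub>R \<phi> h = q + d" by (simp add: d_def)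
      then show ?thesis
        using d qq unfolding Q_def power2_norm_eq_inner
        by (simp add: inner_add_left inner_add_right inner_commute[of d q])
    qed
    \<comment> \<open>The tilt gains \<open>t * (norm d)\<^sup>2\<close> in the inner product, while
      \<open>\<epsilon> * norm (Q t)\<close> grows by at most
      \<open>t\<^sup>2 * (norm d)\<^sup>2 / 2\<close>, by the arithmetic-geometric mean
      inequality.\<close>
    have "t\<^sup>2 * (norm d)\<^sup>2 < t * (norm d)\<^sup>2"
      using t d by (simp add: power2_eq_square)
    moreover have "0 < t * (norm d)\<^sup>2"
      using t d by simp
    moreover have "2 * (\<epsilon> * norm (Q t)) \<le> \<epsilon>\<^sup>2 + (norm (Q t))\<^sup>2"
      using sum_squares_bound[of \<epsilon> "norm (Q t)"] by simp
    ultimately have "0 < inner (Q t) (x - k *\<^sub>R \<phi> h) - \<epsilon> * norm (Q t)"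
      unfolding i using n by linarith
    then have "0 < k\<^sup>2 / E t * (inner (Q t) (x - k *\<^sub>R \<phi> h) - \<epsilon> * norm (Q t))"
      using t k by simp
    also have "\<dots> = inner lam (x - k *\<^sub>R \<phi> h) - \<epsilon> * norm lam"
      using t by (simp add: lam_def right_diff_distrib diff_divide_distrib)
    finally show ?thesis
      using k(1) l by (simp add: lagr_complete_square[where \<phi> = \<phi>, OF k(1) l(2)])
  qed
  ultimately show ?thesis by blast
qed

theorem lemma2p15:
  fixes c :: "'h::euclidean_space \<Rightarrow> real"
    and \<phi> :: "'h \<Rightarrow> 'v::euclidean_space"
    and x :: 'v
    and \<epsilon> \<eta>bar \<eta>hat \<epsilon>bar cstar :: real
    and fstar hs :: 'h
    and lams :: 'v
  assumes "linear \<phi>"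
    and "pos_homogeneous c"
    and "compact (unit_sublevel c)" and "convex (unit_sublevel c)"
    and "norm x > \<epsilon>" and "\<epsilon> > 0"
    and "\<exists>f. norm (x - \<phi> f) < \<epsilon>"
    and "cstar = lip_value c \<phi> x \<epsilon>"
    and "lip_optimal c \<phi> x \<epsilon> fstar"
    and "\<eta>bar > 0" and "\<eta>hat > 0" and "\<epsilon>bar > 0"
    and "\<eta>bar \<le> cstar" and "cstar < \<eta>hat"
    and "line_err \<phi> x fstar \<le> \<epsilon>bar\<^sup>2" and "\<epsilon>bar\<^sup>2 < \<epsilon>\<^sup>2"
    and "(hs, lams) \<in> unit_sublevel c \<times> dual_set x \<epsilon> \<eta>bar (dual_bound x \<epsilon> \<eta>hat \<epsilon>bar)"
  shows "saddle_point (unit_sublevel c) (dual_set x \<epsilon> \<eta>bar (dual_bound x \<epsilon> \<eta>hat \<epsilon>bar))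
           (lagr \<phi> x \<epsilon>) hs lams
         \<longleftrightarrow> lip_optimal c \<phi> x \<epsilon> (cstar *\<^sub>R hs)
           \<and> lams = (cstar / (norm (\<phi> hs) * sqrt (\<epsilon>\<^sup>2 - line_err \<phi> x hs)))
                    *\<^sub>R (x - cstar *\<^sub>R \<phi> hs)"
proof -
  note lin = \<open>linear \<phi>\<close> and hom = \<open>pos_homogeneous c\<close> and conv = \<open>convex (unit_sublevel c)\<close>
    and opt = \<open>lip_optimal c \<phi> x \<epsilon> fstar\<close>
  define p q where "p = \<phi> fstar" and "q = x - p"
  let ?B = "dual_bound x \<epsilon> \<eta>hat \<epsilon>bar"

  \<comment> \<open>Lower bound for the inner product of \<open>q\<close> and
    \<open>p\<close>\<close>
  have k: "0 < cstar" using assms by linarith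
  have cf: "c fstar = cstar" using lip_optimal_value[OF opt] assms by simp
  have pos: "0 < c fstar" using k cf by simp
  have nq: "norm q = \<epsilon>"
    unfolding q_def p_def by (rule lip_optimal_residual[OF lin hom opt pos])
  have "c 0 = 0"
    using hom by (auto simp: pos_homogeneous_def dest!: spec[of _ 0])
  then have "0 \<le> inner q p"
    using lip_variational_inequality[OF lin hom conv opt pos, of 0] pos lin
    by (simp add: q_def p_def linear_0)
  \<comment> \<open>The left side is the denominator of \<open>dual_bound\<close>. Its factors bound
    \<open>norm p\<close> and the square root in \<open>line_err_residual\<close> (with
    \<open>k = 1\<close>) from below.\<close>
  moreover have "(norm x - \<epsilon>) * sqrt (\<epsilon>\<^sup>2 - \<epsilon>bar\<^sup>2) \<le> \<bar>inner q p\<bar>"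
  proof -
    have "norm x - \<epsilon> \<le> norm p"
      using norm_triangle_ineq[of q p] nq by (simp add: q_def)
    moreover have "\<epsilon>bar \<le> \<epsilon>"
      using assms by (intro power2_le_imp_le[of \<epsilon>bar]) linarith+
    ultimately have "(norm x - \<epsilon>) * sqrt (\<epsilon>\<^sup>2 - \<epsilon>bar\<^sup>2) \<le> norm p * sqrt (\<epsilon>\<^sup>2 - line_err \<phi> x fstar)"
      using assms by (intro mult_mono real_sqrt_le_mono) auto
    then show ?thesis
      using line_err_residual[of \<phi> fstar x 1] nq by (simp add: q_def p_def)
  qed
  moreover have pos_gap: "0 < (norm x - \<epsilon>) * sqrt (\<epsilon>\<^sup>2 - \<epsilon>bar\<^sup>2)"
    using assms by simp
  ultimately have gap: "(norm x - \<epsilon>) * sqrt (\<epsilon>\<^sup>2 - \<epsilon>bar\<^sup>2) \<le> inner q p" and D: "0 < inner q p"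
    by linarith+
  have x_q: "x - q = p" by (simp add: q_def)

  \<comment> \<open>The explicit multiplier and its place in the dual set\<close>
  define lam0 where "lam0 = (cstar\<^sup>2 / inner q p) *\<^sub>R q"
  have E: "inner q x - \<epsilon> * norm q = inner q p"
    using power2_norm_eq_inner[of q] nq
    by (simp add: x_q[symmetric] inner_diff_right power2_eq_square)
  note l0 = dual_l_rescaled[where q = q and lam = lam0 and x = x and \<epsilon> = \<epsilon>,
      unfolded E, OF k D lam0_def]
  have norm_lam0: "cstar\<^sup>2 / inner q p * \<epsilon> < ?B"
  proof -
    have "cstar\<^sup>2 / inner q p * \<epsilon> = \<epsilon> * cstar\<^sup>2 / inner q p" by simp
    also have "\<dots> \<le> \<epsilon> * cstar\<^sup>2 / ((norm x - \<epsilon>) * sqrt (\<epsilon>\<^sup>2 - \<epsilon>bar\<^sup>2))"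
      using gap pos_gap D assms by (intro divide_left_mono) auto
    \<comment> \<open>Strictness comes from \<open>cstar < \<eta>hat\<close>; the later perturbation
      of \<open>lam0\<close> relies on it.\<close>
    also have "\<dots> < ?B"
      unfolding dual_bound_def
      using pos_gap k assms by (intro divide_strict_right_mono) (auto intro: power_strict_mono)
    finally show ?thesis .
  qed
  have lam0_mem: "lam0 \<in> dual_set x \<epsilon> \<eta>bar ?B"
    using l0 norm_lam0 assms nq D by (simp add: dual_set_def) (simp add: lam0_def)

  \<comment> \<open>Saddle inequalities at the value \<open>cstar\<close>\<close>
  have lam0_value: "lagr \<phi> x \<epsilon> lam0 h = cstar" if "cstar *\<^sub>R \<phi> h = p" for h
    using lagr_complete_square[where \<phi> = \<phi> and h = h, OF k l0(2)] that l0(1) nq D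
    by (simp add: lam0_def x_q flip: q_def power2_norm_eq_inner)
       (simp add: power2_eq_square flip: power2_norm_eq_inner)
  have dual_ineq: "lagr \<phi> x \<epsilon> lam h \<le> cstar"
    if "cstar *\<^sub>R \<phi> h = p" "lam \<in> dual_set x \<epsilon> \<eta>bar ?B" for h lam
    using that nq by (intro lagr_le_value[OF k]) (auto simp: dual_set_def simp flip: q_def)
  \<comment> \<open>Since \<open>dual_l x \<epsilon> lam0 = cstar\<close>, it suffices that
    \<open>inner lam0 (\<phi> h) \<le> cstar\<close>, which is the variational inequality at
    \<open>cstar *\<^sub>R h\<close> after scaling.\<close>
  have primal_ineq: "cstar \<le> lagr \<phi> x \<epsilon> lam0 h" if "h \<in> unit_sublevel c" for h
  proof -
    have "c (cstar *\<^sub>R h) \<le> c fstar"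
      using that hom k cf by (simp add: unit_sublevel_def pos_homogeneous_def)
    then have "inner q (\<phi> (cstar *\<^sub>R h) - p) \<le> 0"
      using lip_variational_inequality[OF lin hom conv opt pos] by (simp add: q_def p_def)
    then have "cstar * inner q (\<phi> h) \<le> inner q p"
      using lin by (simp add: linear_scale inner_diff_right)
    then have "cstar / inner q p * (cstar * inner q (\<phi> h)) \<le> cstar / inner q p * inner q p"
      using k D by (intro mult_left_mono) auto
    then have "inner lam0 (\<phi> h) \<le> cstar"
      using D by (simp add: lam0_def power2_eq_square)
    then show ?thesis
      using l0(1) by (simp add: lagr_def)
  qed
  have formula: "(cstar / (norm (\<phi> hs) * sqrt (\<epsilon>\<^sup>2 - line_err \<phi> x hs))) *\<^sub>R (x - cstar *\<^sub>R \<phi> hs) = lam0"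
    if p: "cstar *\<^sub>R \<phi> hs = p"
  proof -
    have "norm (\<phi> hs) * sqrt (\<epsilon>\<^sup>2 - line_err \<phi> x hs) = \<bar>inner q (\<phi> hs)\<bar>"
      using line_err_residual[of \<phi> hs x cstar] p nq by (simp flip: q_def)
    also have "inner q (\<phi> hs) = inner q p / cstar"
      using k by (simp flip: p)
    finally show ?thesis
      using k D p by (simp add: lam0_def power2_eq_square flip: q_def)
  qed
  have hs: "hs \<in> unit_sublevel c" and lams: "lams \<in> dual_set x \<epsilon> \<eta>bar ?B"
    using assms by auto

  \<comment> \<open>Equivalence of saddle points and primal-dual optima\<close>
  show ?thesis
  proof
    assume "saddle_point (unit_sublevel c) (dual_set x \<epsilon> \<eta>bar ?B) (lagr \<phi> x \<epsilon>) hs lams"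
    then have sp1: "lagr \<phi> x \<epsilon> lam hs \<le> lagr \<phi> x \<epsilon> lams hs"
      and sp2: "lagr \<phi> x \<epsilon> lams hs \<le> lagr \<phi> x \<epsilon> lams h"
      if "lam \<in> dual_set x \<epsilon> \<eta>bar ?B" "h \<in> unit_sublevel c" for lam h
      using that by (auto simp: saddle_point_def)
    define h0 where "h0 = (1 / cstar) *\<^sub>R fstar"
    have h0: "h0 \<in> unit_sublevel c"
      using hom k cf by (simp add: h0_def unit_sublevel_def pos_homogeneous_def)
    have ph0: "cstar *\<^sub>R \<phi> h0 = p"
      using lin k by (simp add: h0_def p_def linear_scale)
    \<comment> \<open>Interchanging with the known saddle point \<open>(h0, lam0)\<close> closes the
      chain \<open>cstar \<le> L(lam0, hs) \<le> L(lams, hs) \<le> L(lams, h0) \<le>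
      cstar\<close>.\<close>
    have eqs: "lagr \<phi> x \<epsilon> lams h0 = cstar" "lagr \<phi> x \<epsilon> lams hs = cstar" "lagr \<phi> x \<epsilon> lam0 hs = cstar"
      using sp1[OF lam0_mem hs] sp2[OF lams h0] dual_ineq[OF ph0 lams] primal_ineq[OF hs] by linarith+
    have "\<epsilon> * norm lams \<le> inner lams x"
      using lams by (simp add: dual_set_def)
    from lagr_eq_value_imp[where \<phi> = \<phi>, OF k this _ nq \<open>\<epsilon> > 0\<close> eqs(1)]
    have "lams = lam0"
      by (simp add: ph0 lam0_def x_q flip: q_def)
    have "inner lam0 (\<phi> hs) = cstar"
      using eqs(3) l0(1) by (simp add: lagr_def)
    then have "cstar * inner q (\<phi> hs) = inner q p"
      using k D by (simp add: lam0_def power2_eq_square field_simps)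
    then have "inner q (x - cstar *\<^sub>R \<phi> hs) = inner q (x - p)"
      by (simp add: inner_diff_right)
    then have wq: "inner q (x - cstar *\<^sub>R \<phi> hs) = \<epsilon>\<^sup>2"
      using nq by (simp flip: q_def power2_norm_eq_inner)
    have "x - cstar *\<^sub>R \<phi> hs = q"
    proof (rule ccontr)
      assume "x - cstar *\<^sub>R \<phi> hs \<noteq> q"
      from lagr_gt_value[where \<phi> = \<phi>, OF k \<open>\<eta>bar \<le> cstar\<close> \<open>\<epsilon> > 0\<close> nq _ _ wq this, of ?B] D norm_lam0
      obtain lam where "lam \<in> dual_set x \<epsilon> \<eta>bar ?B" "cstar < lagr \<phi> x \<epsilon> lam hs"
        unfolding x_q by blast
      then show False
        using sp1[OF _ hs, of lam] eqs(2) by simp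
    qed
    then have ps: "cstar *\<^sub>R \<phi> hs = p"
      by (simp add: q_def)
    have "lip_feasible \<phi> x \<epsilon> (cstar *\<^sub>R hs)"
      using lin ps nq by (simp add: lip_feasible_def linear_scale flip: q_def)
    moreover have "c (cstar *\<^sub>R hs) \<le> c fstar"
      using hs hom k cf by (simp add: unit_sublevel_def pos_homogeneous_def)
    ultimately have "lip_optimal c \<phi> x \<epsilon> (cstar *\<^sub>R hs)"
      using opt unfolding lip_optimal_def is_arg_min_def by fastforce
    then show "lip_optimal c \<phi> x \<epsilon> (cstar *\<^sub>R hs) \<and>
        lams = (cstar / (norm (\<phi> hs) * sqrt (\<epsilon>\<^sup>2 - line_err \<phi> x hs))) *\<^sub>R (x - cstar *\<^sub>R \<phi> hs)"
      using formula[OF ps] \<open>lams = lam0\<close> by simp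
  next
    assume rhs: "lip_optimal c \<phi> x \<epsilon> (cstar *\<^sub>R hs) \<and>
        lams = (cstar / (norm (\<phi> hs) * sqrt (\<epsilon>\<^sup>2 - line_err \<phi> x hs))) *\<^sub>R (x - cstar *\<^sub>R \<phi> hs)"
    then have "\<phi> (cstar *\<^sub>R hs) = \<phi> fstar"
      by (intro lip_optimal_image_unique[OF lin hom conv opt pos]) simp
    then have ps: "cstar *\<^sub>R \<phi> hs = p"
      using lin by (simp add: p_def linear_scale)
    have "lams = lam0"
      using rhs formula[OF ps] by simp
    then show "saddle_point (unit_sublevel c) (dual_set x \<epsilon> \<eta>bar ?B) (lagr \<phi> x \<epsilon>) hs lams"
      using hs lam0_mem lam0_value[OF ps] dual_ineq[OF ps] primal_ineq
      by (simp add: saddle_point_def)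
  qed
qed

end
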